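(* Let $S\subset\mathbb{N}^d$ be the semigroup generated by $\mathbf{m}_1,\dots,\mathbf{m}_n$. If the toric variety $V_{S_{\ell,\mathbf{m}}}\subset\mathbb{A}^{n+1}$ is an extension of $V_S\subset\mathbb{A}^n$, then $S_{\ell,\mathbf{m}}$ is the gluing of $\mathbb{N}T_1$ and $\mathbb{N}T_2$, where $T_1=\{\ell\mathbf{m}_1,\dots,\ell\mathbf{m}_n\}$ and $T_2=\{\mathbf{m}\}$. Consequently, $I_{S_{\ell,\mathbf{m}}}=I_S+\langle F\rangle$, where $F=x_{n+1}^{\ell}-x_1^{s_1}\cdots x_n^{s_n}$ and $s_1,\dots,s_n$ are non-negative integers with $\mathbf{m}=s_1\mathbf{m}_1+\cdots+s_n\mathbf{m}_n$.
   Context: $K$ is an algebraically closed field of any characteristic and $\mathbb{N}$ denotes the non-negative integers. For a subsemigroup $S$ of $\mathbb{N}^d$ generated by $\mathbf{m}_1,\dots,\mathbf{m}_n$, set $\deg_S(x_1^{b_1}\cdots x_n^{b_n})=b_1\mathbf{m}_1+\cdots+b_n\mathbf{m}_n$. The toric ideal $I_S$ of $S$ is the prime ideal in $K[x_1,\dots,x_n]$ generated by the binomials $\mathbf{x}^{\mathbf{a}}-\mathbf{x}^{\mathbf{b}}$ with $\deg_S(\mathbf{x}^{\mathbf{a}})=\deg_S(\mathbf{x}^{\mathbf{b}})$, and the toric variety $V_S\subset\mathbb{A}^n$ is its set of zeroes. For a positive integer $\ell$, $S_{\ell,\mathbf{m}}$ denotes the affine semigroup generated by $\ell\mathbf{m}_1,\dots,\ell\mathbf{m}_n$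 and $\mathbf{m}$; its toric ideal $I_{S_{\ell,\mathbf{m}}}$ lies in $K[x_1,\dots,x_{n+1}]$, with $x_{n+1}$ of degree $\mathbf{m}$. In the sum $I_S+\langle F\rangle$, $I_S$ stands for the ideal it generates in $K[x_1,\dots,x_{n+1}]$. The variety $V_{S_{\ell,\mathbf{m}}}\subset\mathbb{A}^{n+1}$ is an extension of $V_S\subset\mathbb{A}^n$ if $\mathbf{m}\in S$ and $\ell$ is a positive integer relatively prime to a component of $\mathbf{m}$. Gluing: let $T=T_1\sqcup T_2$ be a decomposition of a set $T\subset\mathbb{N}^d$ into two disjoint proper subsets. The semigroup $\mathbb{N}T$ generated by $T$ is called a gluing of $\mathbb{N}T_1$ and $\mathbb{N}T_2$ if there exists a nonzero $\alpha\in\mathbb{N}T_1\cap\mathbb{N}T_2$ such that $\mathbb{Z}\alpha=\mathbb{Z}T_1\cap\mathbb{Z}T_2$.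
   Formalization: The gluing claim is stated only for m nonzero and m not among ℓm_1,…,ℓm_n; otherwise (possible only with ℓ=1) no nonzero α exists or T_1 and T_2 are not disjoint, so it fails. The ideal equality is stated without these conditions. *)

theory Defs
  imports
    "HOL-Analysis.Finite_Cartesian_Product"
    "HOL-Computational_Algebra.Polynomial"
    "HOL-Library.Poly_Mapping"
    "HOL-Library.Set_Algebras"
begin

text \<open>
  The dimensions \<open>d\<close> and \<open>n\<close> are the cardinalities of the finite index types \<open>'d\<close> and \<open>'n\<close>,
  so \<open>d, n \<ge> 1\<close>.  The \<open>n + 1\<close> variables of the extended ring are indexed by \<open>'n option\<close>:
  \<open>Some i\<close> stands for \<open>x\<^sub>i\<close> and \<open>None\<close> for the additional variable.
\<close>

section \<open>Affine semigroups and gluing\<close>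

text \<open>
  Linear combinations of elements of \<open>T\<close> with coefficients in \<open>'r\<close>, including the empty one.
  At type \<^typ>\<open>nat\<close> this is the semigroup \<open>\<nat>T\<close>, at type \<^typ>\<open>int\<close> the group \<open>\<int>T\<close>.
\<close>

definition lin_comb :: "('r::comm_semiring_1 ^ 'd) set \<Rightarrow> ('r ^ 'd) set" where
  "lin_comb T = {(\<Sum>t\<in>A. c t *s t) | A c. finite A \<and> A \<subseteq> T}"

definition int_vec :: "nat ^ 'd \<Rightarrow> int ^ 'd" where
  "int_vec t = (\<chi> j. int (t $ j))"

abbreviation nat_span :: "(nat ^ 'd) set \<Rightarrow> (nat ^ 'd) set" where
  "nat_span T \<equiv> lin_comb T"

abbreviation int_span :: "(nat ^ 'd) set \<Rightarrow> (int ^ 'd) set" where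
  "int_span T \<equiv> lin_comb (int_vec ` T)"

text \<open>
  \<open>T\<^sub>1\<close> and \<open>T\<^sub>2\<close> are sets, not families: for \<open>T\<^sub>2 = {v}\<close> there is no gluing if \<open>v \<in> T\<^sub>1\<close>, and
  none if \<open>v = 0\<close>, since \<open>\<alpha>\<close> has to be nonzero.
\<close>

definition is_gluing :: "(nat ^ 'd) set \<Rightarrow> (nat ^ 'd) set \<Rightarrow> (nat ^ 'd) set \<Rightarrow> bool" where
  "is_gluing S T\<^sub>1 T\<^sub>2 \<longleftrightarrow>
     (\<exists>T. T = T\<^sub>1 \<union> T\<^sub>2 \<and> T\<^sub>1 \<inter> T\<^sub>2 = {} \<and> T\<^sub>1 \<subset> T \<and> T\<^sub>2 \<subset> T \<and> S = nat_span T \<and>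
        (\<exists>\<alpha>. \<alpha> \<noteq> 0 \<and> \<alpha> \<in> nat_span T\<^sub>1 \<inter> nat_span T\<^sub>2 \<and>
             int_span {\<alpha>} = int_span T\<^sub>1 \<inter> int_span T\<^sub>2))"

text \<open>The generators \<open>l m\<^sub>1, \<dots>, l m\<^sub>n, v\<close> of \<open>S\<^bsub>l,v\<^esub>\<close>.\<close>

definition ext_gens :: "('n \<Rightarrow> nat ^ 'd) \<Rightarrow> nat \<Rightarrow> nat ^ 'd \<Rightarrow> 'n option \<Rightarrow> nat ^ 'd" where
  "ext_gens m l v k = (case k of Some i \<Rightarrow> l *s m i | None \<Rightarrow> v)"

section \<open>Polynomials\<close>

type_synonym ('n, 'k) mpoly = "('n \<Rightarrow>\<^sub>0 nat) \<Rightarrow>\<^sub>0 'k"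

definition Var :: "'n \<Rightarrow> ('n, 'k::comm_ring_1) mpoly" where
  "Var i = Poly_Mapping.single (Poly_Mapping.single i 1) 1"

definition const :: "'k \<Rightarrow> ('n, 'k::comm_ring_1) mpoly" where
  "const c = Poly_Mapping.single 0 c"

definition eval_poly ::
    "('k::comm_ring_1 \<Rightarrow> 'r::comm_ring_1) \<Rightarrow> ('n::finite \<Rightarrow> 'r) \<Rightarrow> ('n, 'k) mpoly \<Rightarrow> 'r" where
  "eval_poly h x p = (\<Sum>b\<in>Poly_Mapping.keys p.
     h (Poly_Mapping.lookup p b) * (\<Prod>i\<in>UNIV. x i ^ Poly_Mapping.lookup b i))"

text \<open>The inclusion of \<open>K[x\<^sub>1,\<dots>,x\<^sub>n]\<close> in the ring with the additional variable.\<close>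

definition embed_poly :: "('n::finite, 'k::comm_ring_1) mpoly \<Rightarrow> ('n option, 'k) mpoly" where
  "embed_poly p = eval_poly const (\<lambda>i. Var (Some i)) p"

abbreviation ideal_of :: "'r::comm_ring_1 set \<Rightarrow> 'r set" where
  "ideal_of B \<equiv> module.span (*) B"

section \<open>Toric ideals, toric varieties and extensions\<close>

text \<open>
  As usual, \<open>I\<^sub>S\<close>, \<open>V\<^sub>S\<close> and \<open>deg\<^sub>S\<close> are attached to the list of generators of \<open>S\<close>, here a function
  on the index type of the variables.
\<close>

definition degS :: "('n::finite \<Rightarrow> nat ^ 'd) \<Rightarrow> ('n \<Rightarrow> nat) \<Rightarrow> nat ^ 'd" where
  "degS m b = (\<Sum>i\<in>UNIV. b i *s m i)"

definition toric_ideal :: "('n::finite \<Rightarrow> nat ^ 'd) \<Rightarrow> ('n, 'k::comm_ring_1) mpoly set" where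
  "toric_ideal m = ideal_of
     {(\<Prod>i\<in>UNIV. Var i ^ a i) - (\<Prod>i\<in>UNIV. Var i ^ b i) | a b. degS m a = degS m b}"

definition toric_variety :: "('n::finite \<Rightarrow> nat ^ 'd) \<Rightarrow> ('k::comm_ring_1 ^ 'n) set" where
  "toric_variety m = {x. \<forall>p\<in>toric_ideal m. eval_poly id (\<lambda>i. x $ i) p = 0}"

text \<open>
  \<open>W\<close> is an extension of \<open>V = V\<^sub>S\<close>, where \<open>W = V\<^bsub>S\<^bsub>l,v\<^esub>\<^esub>\<close>.  Being an extension is a condition on the
  data \<open>m, l, v\<close> defining the two varieties, not on the point sets alone.
\<close>

definition is_extension ::
    "('k::comm_ring_1 ^ 'n option) set \<Rightarrow> ('k ^ 'n::finite) set \<Rightarrow>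
     ('n \<Rightarrow> nat ^ 'd) \<Rightarrow> nat \<Rightarrow> nat ^ 'd \<Rightarrow> bool" where
  "is_extension W V m l v \<longleftrightarrow>
     W = toric_variety (ext_gens m l v) \<and> V = toric_variety m \<and>
     v \<in> nat_span (range m) \<and> l > 0 \<and> (\<exists>j. coprime l (v $ j))"

end

theory Submission
  imports Defs
begin

text \<open>
  Reading a relation \<open>z v = \<Sum> c\<^sub>i l m\<^sub>i\<close> in the component of \<open>v\<close> that is prime to \<open>l\<close> gives \<open>l dvd z\<close>.
  So \<open>\<int>T\<^sub>1 \<inter> \<int>T\<^sub>2\<close> is generated by \<open>\<alpha> = l v\<close>.  Likewise, in a binomial
  \<open>x\<^sup>a y\<^sup>p - x\<^sup>b y\<^sup>q\<close> of the toric ideal of \<open>S\<^bsub>l,v\<^esub>\<close> with \<open>p \<ge> q\<close>, where \<open>y\<close> is the additional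
  variable, \<open>p = q + l r\<close>, hence \<open>deg\<^sub>S (x\<^sup>a x\<^bsup>r s\<^esup>) = deg\<^sub>S (x\<^sup>b)\<close> and
  \<open>x\<^sup>a y\<^sup>p - x\<^sup>b y\<^sup>q = y\<^sup>q (x\<^sup>a x\<^bsup>r s\<^esup> - x\<^sup>b) + x\<^sup>a y\<^sup>q ((y\<^sup>l)\<^sup>r - (x\<^sup>s)\<^sup>r)\<close>, where \<open>y\<^sup>l - x\<^sup>s\<close> divides the
  last factor.
\<close>

section \<open>Linear combinations and gluing\<close>

text \<open>\<open>lin_comb\<close> sums over sets of vectors, whereas generators come as a family
  that may repeat. One direction chooses indices \<open>B\<close> meeting each used vector exactly
  once and gives the others coefficient 0; the converse adds up coefficients over the fibres of
  \<open>f\<close>.\<close>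

lemma lin_comb_range:
  fixes f :: "'n::finite \<Rightarrow> 'r::comm_semiring_1 ^ 'd"
  shows "lin_comb (range f) = {\<Sum>i\<in>UNIV. c i *s f i | c. True}"
proof (intro equalityI subsetI)
  fix x assume "x \<in> lin_comb (range f)"
  then obtain A c where A: "A \<subseteq> range f" and x: "x = (\<Sum>t\<in>A. c t *s t)"
    unfolding lin_comb_def by blast
  obtain B where B: "inj_on f B" "A = f ` B"
    using A by (meson subset_image_inj)
  have "x = (\<Sum>i\<in>UNIV. (if i \<in> B then c (f i) else 0) *s f i)"
    unfolding x B(2) sum.reindex[OF B(1)] o_def
    by (rule sum.mono_neutral_cong_left) auto
  then show "x \<in> {\<Sum>i\<in>UNIV. c i *s f i | c. True}"
    by (intro CollectI exI conjI TrueI)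
next
  fix x assume "x \<in> {\<Sum>i\<in>UNIV. c i *s f i | c. True}"
  then obtain c where x: "x = (\<Sum>i\<in>UNIV. c i *s f i)" by blast
  have "x = (\<Sum>t\<in>range f. \<Sum>i\<in>{i \<in> UNIV. f i = t}. c i *s f i)"
    unfolding x by (rule sum.group[symmetric]) auto
  also have "\<dots> = (\<Sum>t\<in>range f. (\<Sum>i\<in>{i. f i = t}. c i) *s t)"
    by (intro sum.cong refl) (auto simp: vec_eq_iff sum_distrib_right intro!: sum.cong)
  finally show "x \<in> lin_comb (range f)"
    unfolding lin_comb_def by (auto intro!: exI[of _ "range f"])
qed

lemma lin_comb_singleton: "lin_comb {t} = {c *s t | c. True}"
  using lin_comb_range[of "\<lambda>_::unit. t"] by (auto simp: UNIV_unit)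

lemma range_ext_gens: "range (ext_gens m l v) = range (\<lambda>i. l *s m i) \<union> {v}"
  by (auto simp: ext_gens_def UNIV_option_conv image_image)

text \<open>The last two assumptions exclude degenerate extensions, which occur only for
  \<open>l = 1\<close>: if \<open>v = 0\<close> or \<open>v = l *s m i\<close>, then
  \<open>l\<close> divides every component of \<open>v\<close>, also the one prime to
  \<open>l\<close>.\<close>

lemma is_gluing_extension:
  fixes m :: "'n::finite \<Rightarrow> nat ^ 'd"
  assumes v: "v \<in> nat_span (range m)" and l: "l > 0" and j: "coprime l (v $ j)"
    and "v \<noteq> 0" and disj: "v \<notin> range (\<lambda>i. l *s m i)"
  shows "is_gluing (nat_span (range (ext_gens m l v))) (range (\<lambda>i. l *s m i)) {v}"
proof -
  let ?T\<^sub>1 = "range (\<lambda>i. l *s m i)"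
  obtain s where s: "v = (\<Sum>i\<in>UNIV. s i *s m i)"
    using v unfolding lin_comb_range by blast
  have lv: "l *s v = (\<Sum>i\<in>UNIV. s i *s (l *s m i))"
    by (simp add: s vec_eq_iff sum_distrib_left mult.left_commute)
  have int_T\<^sub>1: "int_span ?T\<^sub>1 = {\<Sum>i\<in>UNIV. c i *s int_vec (l *s m i) | c. True}"
    unfolding image_image by (rule lin_comb_range)
  have "int_span {l *s v} = int_span ?T\<^sub>1 \<inter> int_span {v}"
  proof (intro equalityI subsetI)
    fix x assume "x \<in> int_span {l *s v}"
    then obtain z where x: "x = z *s int_vec (l *s v)"
      by (auto simp: lin_comb_singleton)
    have "x = (\<Sum>i\<in>UNIV. (z * int (s i)) *s int_vec (l *s m i))"
      unfolding x lv by (simp add: int_vec_def vec_eq_iff sum_distrib_left mult.assoc)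
    moreover have "x = (z * int l) *s int_vec v"
      unfolding x by (simp add: int_vec_def vec_eq_iff)
    ultimately show "x \<in> int_span ?T\<^sub>1 \<inter> int_span {v}"
      unfolding int_T\<^sub>1 image_insert image_empty lin_comb_singleton
      by (intro IntI CollectI exI conjI TrueI)
  next
    fix x assume "x \<in> int_span ?T\<^sub>1 \<inter> int_span {v}"
    then obtain c z where c: "x = (\<Sum>i\<in>UNIV. c i *s int_vec (l *s m i))"
      and z: "x = z *s int_vec v"
      unfolding int_T\<^sub>1 image_insert image_empty lin_comb_singleton by blast
    have "int l dvd x $ j"
      unfolding c by (auto simp: int_vec_def intro!: dvd_sum)
    then have "int l dvd z * int (v $ j)" by (simp add: z int_vec_def)
    with j have "int l dvd z" by (simp add: coprime_dvd_mult_left_iff)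
    then obtain w where "z = int l * w" by blast
    then have "x = w *s int_vec (l *s v)" by (simp add: z int_vec_def vec_eq_iff)
    then show "x \<in> int_span {l *s v}" by (auto simp: lin_comb_singleton)
  qed
  moreover have "l *s v \<noteq> 0"
    using l \<open>v \<noteq> 0\<close> by (auto simp: vec_eq_iff)
  moreover have "l *s v \<in> nat_span ?T\<^sub>1 \<inter> nat_span {v}"
    using lv unfolding lin_comb_range lin_comb_singleton by blast
  ultimately have "\<exists>\<alpha>. \<alpha> \<noteq> 0 \<and> \<alpha> \<in> nat_span ?T\<^sub>1 \<inter> nat_span {v} \<and>
      int_span {\<alpha>} = int_span ?T\<^sub>1 \<inter> int_span {v}"
    by (intro exI[of _ "l *s v"] conjI)
  moreover have "?T\<^sub>1 \<inter> {v} = {}" "?T\<^sub>1 \<subset> ?T\<^sub>1 \<union> {v}"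
    using disj by auto
  \<comment> \<open>The index type is nonempty, so there is some \<open>l *s m i\<close>, and it
    differs from \<open>v\<close>.\<close>
  moreover have "{v} \<subset> ?T\<^sub>1 \<union> {v}"
    using disj UNIV_not_empty by fast
  ultimately show ?thesis
    unfolding is_gluing_def range_ext_gens
    by (intro exI[of _ "?T\<^sub>1 \<union> {v}"] conjI refl)
qed

section \<open>Evaluation of polynomials\<close>

text \<open>Since \<open>h 0 = 0\<close>, terms outside the support vanish, so several polynomials
  can be evaluated over one common set of exponents.\<close>

lemma eval_poly_superset:
  assumes "finite A" "Poly_Mapping.keys p \<subseteq> A" "h 0 = 0"
  shows "eval_poly h x p = (\<Sum>b\<in>A.
    h (Poly_Mapping.lookup p b) * (\<Prod>i\<in>UNIV. x i ^ Poly_Mapping.lookup b i))"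
  unfolding eval_poly_def using assms
  by (intro sum.mono_neutral_left) (auto simp: in_keys_iff)

lemma eval_poly_add:
  assumes "h 0 = 0" "\<And>a b. h (a + b) = h a + h b"
  shows "eval_poly h x (p + q) = eval_poly h x p + eval_poly h x q"
proof -
  let ?A = "Poly_Mapping.keys p \<union> Poly_Mapping.keys q"
  have "eval_poly h x r = (\<Sum>b\<in>?A.
      h (Poly_Mapping.lookup r b) * (\<Prod>i\<in>UNIV. x i ^ Poly_Mapping.lookup b i))"
    if "Poly_Mapping.keys r \<subseteq> ?A" for r
    using that assms(1) by (intro eval_poly_superset) auto
  from this[of p] this[of q] this[of "p + q"] show ?thesis
    by (simp add: keys_add lookup_add assms(2) distrib_right sum.distrib)
qed

lemma eval_poly_single:
  assumes "h 0 = 0"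
  shows "eval_poly h x (Poly_Mapping.single b c) =
    h c * (\<Prod>i\<in>UNIV. x i ^ Poly_Mapping.lookup b i)"
  using eval_poly_superset[of "{b}" "Poly_Mapping.single b c" h x] assms by simp

text \<open>Updating at a key outside the support is the same as adding a monomial. This form of
  induction fits additive maps.\<close>

lemma poly_mapping_single_induct [case_names zero add]:
  fixes p :: "'a \<Rightarrow>\<^sub>0 'b::comm_monoid_add"
  assumes "P 0" and "\<And>b c p. P p \<Longrightarrow> P (Poly_Mapping.single b c + p)"
  shows "P p"
proof (induction p rule: update_induct)
  case const
  show ?case by (rule assms(1))
next
  case (update p b c)
  have "Poly_Mapping.update b c p = Poly_Mapping.single b c + p"
    using update.hyps
    by (intro poly_mapping_eqI) (auto simp: lookup_update lookup_add lookup_single in_keys_iff)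
  with assms(2) update.IH show ?case by simp
qed

text \<open>Both sides are additive in \<open>p\<close> and in \<open>q\<close>, so two nested
  inductions reduce the claim to a product of two monomials.\<close>

lemma eval_poly_mult:
  assumes h: "h 0 = 0" "\<And>a b. h (a + b) = h a + h b" "\<And>a b. h (a * b) = h a * h b"
  shows "eval_poly h x (p * q) = eval_poly h x p * eval_poly h x q"
proof (induction p rule: poly_mapping_single_induct)
  case zero
  show ?case by (simp add: eval_poly_def)
next
  case (add b c p)
  have "eval_poly h x (Poly_Mapping.single b c * q) =
      eval_poly h x (Poly_Mapping.single b c) * eval_poly h x q"
  proof (induction q rule: poly_mapping_single_induct)
    case zero
    show ?case by (simp add: eval_poly_def)
  next
    case (add b' c' q)
    then show ?case
      by (simp add: distrib_left eval_poly_add h(1,2) mult_single eval_poly_single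
          h(3) lookup_add power_add prod.distrib ac_simps)
  qed
  with add show ?case by (simp add: distrib_right eval_poly_add h(1,2))
qed

lemma const_hom:
  "const 0 = 0" "const (a + b) = const a + const b" "const (a * b) = const a * const b"
  by (simp_all add: const_def single_add mult_single)

lemma embed_poly_add: "embed_poly (p + q) = embed_poly p + embed_poly q"
  unfolding embed_poly_def by (rule eval_poly_add) (simp_all add: const_hom)

lemma embed_poly_mult: "embed_poly (p * q) = embed_poly p * embed_poly q"
  unfolding embed_poly_def by (rule eval_poly_mult) (simp_all add: const_hom)

lemma embed_poly_0: "embed_poly 0 = 0"
  by (simp add: embed_poly_def eval_poly_def)

lemma embed_poly_1: "embed_poly 1 = 1"
  using eval_poly_single[of const "\<lambda>i. Var (Some i)" 0 1]
  by (simp add: embed_poly_def const_hom) (simp add: const_def)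

lemma embed_poly_diff: "embed_poly (p - q) = embed_poly p - embed_poly q"
  using embed_poly_add[of "p - q" q] by simp

lemma embed_poly_Var: "embed_poly (Var i) = Var (Some i)"
proof -
  have "(\<Prod>j\<in>UNIV. Var (Some j) ^ Poly_Mapping.lookup (Poly_Mapping.single i 1) j) =
      (\<Prod>j\<in>UNIV. if j = i then Var (Some j) else (1 :: ('a option, 'b) mpoly))"
    by (intro prod.cong) (auto simp: lookup_single)
  then show ?thesis
    by (simp add: embed_poly_def Var_def[of i] eval_poly_single const_hom(1))
       (simp add: const_def)
qed

lemma embed_poly_power: "embed_poly (p ^ k) = embed_poly p ^ k"
  by (induction k) (simp_all add: embed_poly_1 embed_poly_mult)

lemma embed_poly_prod: "embed_poly (\<Prod>i\<in>A. f i) = (\<Prod>i\<in>A. embed_poly (f i))"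
  by (induction A rule: infinite_finite_induct) (simp_all add: embed_poly_1 embed_poly_mult)

section \<open>Toric ideals of extensions\<close>

text \<open>Over the ring as a module over itself, subspaces are the ideals and \<open>span\<close>
  gives the ideal generated by a set.\<close>

interpretation ideal: module "(*) :: 'r::comm_ring_1 \<Rightarrow> 'r \<Rightarrow> 'r"
  by unfold_locales (simp_all add: algebra_simps)

lemma ideal_of_plus: "ideal_of A + ideal_of B = ideal_of (A \<union> B)"
  by (auto simp: ideal.span_Un set_plus_def)

lemma toric_ideal_binomial:
  "degS m a = degS m b \<Longrightarrow>
    (\<Prod>i\<in>UNIV. Var i ^ a i) - (\<Prod>i\<in>UNIV. Var i ^ b i) \<in> toric_ideal m"
  unfolding toric_ideal_def by (rule ideal.span_base) blast

text \<open>The preimage of an ideal under a ring homomorphism is an ideal; inclusions of embedded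
  ideals can therefore be checked on generators.\<close>

lemma subspace_embed_poly_vimage:
  "ideal.subspace J \<Longrightarrow> ideal.subspace {p. embed_poly p \<in> J}"
  unfolding ideal.subspace_def by (simp add: embed_poly_0 embed_poly_add embed_poly_mult)

lemma prod_option:
  fixes g :: "'n::finite option \<Rightarrow> 'r::comm_monoid_mult"
  shows "(\<Prod>k\<in>UNIV. g k) = g None * (\<Prod>i\<in>UNIV. g (Some i))"
  by (simp add: UNIV_option_conv prod.reindex)

lemma degS_ext_gens:
  "degS (ext_gens m l v) a = a None *s v + l *s degS m (a \<circ> Some)"
proof -
  have "degS (ext_gens m l v) a = a None *s v + (\<Sum>i\<in>UNIV. a (Some i) *s (l *s m i))"
    by (simp add: degS_def UNIV_option_conv sum.reindex ext_gens_def)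
  also have "(\<Sum>i\<in>UNIV. a (Some i) *s (l *s m i)) = l *s degS m (a \<circ> Some)"
    by (simp add: degS_def vec_eq_iff sum_distrib_left mult.left_commute)
  finally show ?thesis .
qed

lemma embed_toric_ideal_subset:
  fixes m :: "'n::finite \<Rightarrow> nat ^ 'd"
  shows "embed_poly ` toric_ideal m \<subseteq>
    (toric_ideal (ext_gens m l v) :: ('n option, 'k::comm_ring_1) mpoly set)"
proof -
  let ?J = "toric_ideal (ext_gens m l v) :: ('n option, 'k) mpoly set"
  have "toric_ideal m \<subseteq> {p. embed_poly p \<in> ?J}"
    unfolding toric_ideal_def[of m]
  proof (rule ideal.span_minimal)
    show "ideal.subspace {p. embed_poly p \<in> ?J}"
      by (rule subspace_embed_poly_vimage) (simp add: toric_ideal_def)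
  next
    have "embed_poly ((\<Prod>i\<in>UNIV. Var i ^ a i) - (\<Prod>i\<in>UNIV. Var i ^ b i)) \<in> ?J"
      if "degS m a = degS m b" for a b
      \<comment> \<open>Exponent 0 at the additional variable: the new degrees are \<open>l\<close>
        times the old ones, so they still agree.\<close>
      using toric_ideal_binomial[of "ext_gens m l v" "case_option 0 a" "case_option 0 b"] that
      by (simp add: degS_ext_gens prod_option comp_def embed_poly_diff embed_poly_prod
          embed_poly_power embed_poly_Var)
    then show "{(\<Prod>i\<in>UNIV. Var i ^ a i) - (\<Prod>i\<in>UNIV. Var i ^ b i) |a b. degS m a = degS m b}
        \<subseteq> {p. embed_poly p \<in> ?J}"
      by blast
  qed
  then show ?thesis by blast
qed

text \<open>An arbitrary ideal \<open>J\<close> containing the embedded toric ideal and the binomial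
  F contains both summands of the decomposition given at the start. The order of the exponents in
  \<open>le\<close> costs no generality, as the binomial may be negated.\<close>

lemma ext_binomial_mem:
  fixes m :: "'n::finite \<Rightarrow> nat ^ 'd" and a b :: "'n option \<Rightarrow> nat"
    and J :: "('n option, 'k::comm_ring_1) mpoly set"
  assumes J: "ideal.subspace J" and emb: "embed_poly ` toric_ideal m \<subseteq> J"
    and F: "Var None ^ l - (\<Prod>i\<in>UNIV. Var (Some i) ^ s i) \<in> J"
    and l: "l > 0" and j: "coprime l (v $ j)" and v: "v = degS m s"
    and deg: "degS (ext_gens m l v) a = degS (ext_gens m l v) b"
    and le: "b None \<le> a None"
  shows "(\<Prod>k\<in>UNIV. Var k ^ a k) - (\<Prod>k\<in>UNIV. Var k ^ b k) \<in> J"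
proof -
  define X where "X c = (\<Prod>i\<in>UNIV. Var (Some i) ^ c i :: ('n option, 'k) mpoly)" for c
  let ?y = "Var None :: ('n option, 'k) mpoly"
  let ?q = "b None"
  have eq: "a None * v $ i + l * degS m (a \<circ> Some) $ i =
      ?q * v $ i + l * degS m (b \<circ> Some) $ i" for i
    using arg_cong[OF deg, of "\<lambda>x. x $ i"] by (simp add: degS_ext_gens)
  \<comment> \<open>From here on \<open>p\<close> is the difference of the two exponents of the
    additional variable, not the larger exponent.\<close>
  obtain p where p: "a None = ?q + p"
    using le le_iff_add by blast
  have "l dvd p * v $ j"
  proof -
    have "p * v $ j + l * degS m (a \<circ> Some) $ j = l * degS m (b \<circ> Some) $ j"
      using eq[of j] by (simp add: p algebra_simps)
    then show ?thesis by (metis dvd_add_left_iff dvd_triv_left)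
  qed
  with j have "l dvd p" by (simp add: coprime_dvd_mult_left_iff)
  then obtain r where r: "p = l * r" by blast
  \<comment> \<open>With \<open>p = l * r\<close>, the positive factor \<open>l\<close> cancels in
    every component.\<close>
  have "r * v $ i + degS m (a \<circ> Some) $ i = degS m (b \<circ> Some) $ i" for i
  proof -
    have "l * (r * v $ i + degS m (a \<circ> Some) $ i) = l * degS m (b \<circ> Some) $ i"
      using eq[of i] by (simp add: p r algebra_simps)
    with l show ?thesis by simp
  qed
  then have "degS m (\<lambda>i. a (Some i) + r * s i) = degS m (\<lambda>i. b (Some i))"
    by (simp add: v degS_def vec_eq_iff sum.distrib sum_distrib_left algebra_simps)
  from toric_ideal_binomial[OF this] emb
  have "X (\<lambda>i. a (Some i) + r * s i) - X (\<lambda>i. b (Some i)) \<in> J"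
    by (force simp: X_def embed_poly_diff embed_poly_prod embed_poly_power embed_poly_Var)
  moreover have "X (\<lambda>i. a (Some i) + r * s i) = X (\<lambda>i. a (Some i)) * X s ^ r"
    by (simp add: X_def power_add prod.distrib prod_power_distrib power_mult[symmetric]
        mult.commute[of r])
  ultimately have "?y ^ ?q * (X (\<lambda>i. a (Some i)) * X s ^ r - X (\<lambda>i. b (Some i))) \<in> J"
    using J by (simp add: ideal.subspace_scale)
  \<comment> \<open>A difference of \<open>r\<close>-th powers is a multiple of the difference of
    the bases, which is F.\<close>
  moreover have "(?y ^ l) ^ r - X s ^ r \<in> J"
    unfolding power_diff_sumr2 mult.commute[of "?y ^ l - X s"]
    using J F by (auto simp: X_def intro: ideal.subspace_scale)
  then have "X (\<lambda>i. a (Some i)) * ?y ^ ?q * ((?y ^ l) ^ r - X s ^ r) \<in> J"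
    using J by (rule ideal.subspace_scale[rotated])
  ultimately have "?y ^ ?q * (X (\<lambda>i. a (Some i)) * X s ^ r - X (\<lambda>i. b (Some i))) +
      X (\<lambda>i. a (Some i)) * ?y ^ ?q * ((?y ^ l) ^ r - X s ^ r) \<in> J"
    using J by (simp add: ideal.subspace_add)
  \<comment> \<open>The two products containing \<open>X s ^ r\<close> cancel.\<close>
  also have "?y ^ ?q * (X (\<lambda>i. a (Some i)) * X s ^ r - X (\<lambda>i. b (Some i))) +
      X (\<lambda>i. a (Some i)) * ?y ^ ?q * ((?y ^ l) ^ r - X s ^ r) =
      ?y ^ a None * X (\<lambda>i. a (Some i)) - ?y ^ ?q * X (\<lambda>i. b (Some i))"
    unfolding p r power_add power_mult
    by (simp only: right_diff_distrib mult.assoc mult.left_commute mult.commute) simp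
  finally show ?thesis by (simp add: prod_option X_def)
qed

text \<open>The sum of the two ideals is generated by the union of their generating sets, so each
  inclusion is checked on generators.\<close>

lemma toric_ideal_extension:
  fixes m :: "'n::finite \<Rightarrow> nat ^ 'd"
  assumes l: "l > 0" and j: "coprime l (v $ j)" and v: "v = degS m s"
  shows "(toric_ideal (ext_gens m l v) :: ('n option, 'k::comm_ring_1) mpoly set) =
    ideal_of (embed_poly ` toric_ideal m) +
    ideal_of {Var None ^ l - (\<Prod>i\<in>UNIV. Var (Some i) ^ s i)}"
proof -
  let ?F = "Var None ^ l - (\<Prod>i\<in>UNIV. Var (Some i) ^ s i) :: ('n option, 'k) mpoly"
  let ?J = "ideal_of (embed_poly ` toric_ideal m \<union> {?F})"
  \<comment> \<open>F is itself one of the defining binomials: both of its monomials have degree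
    \<open>l *s v\<close>.\<close>
  have "?F \<in> toric_ideal (ext_gens m l v)"
    using toric_ideal_binomial[of "ext_gens m l v" "case_option l (\<lambda>_. 0)" "case_option 0 s"]
    by (simp add: degS_ext_gens prod_option comp_def v) (simp add: degS_def)
  then have "?J \<subseteq> toric_ideal (ext_gens m l v)"
    using embed_toric_ideal_subset[of m l v]
    by (intro ideal.span_minimal) (auto simp: toric_ideal_def[of "ext_gens m l v"])
  moreover have "toric_ideal (ext_gens m l v) \<subseteq> ?J"
  proof -
    note mem = ext_binomial_mem[OF ideal.subspace_span[of "embed_poly ` toric_ideal m \<union> {?F}"]
        _ _ l j v]
    have "(\<Prod>k\<in>UNIV. Var k ^ a k) - (\<Prod>k\<in>UNIV. Var k ^ b k) \<in> ?J"
      if deg: "degS (ext_gens m l v) a = degS (ext_gens m l v) b" for a b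
    proof (cases "b None \<le> a None")
      case True
      then show ?thesis by (intro mem deg) (auto intro: ideal.span_base)
    next
      \<comment> \<open>Exchanging \<open>a\<close> and \<open>b\<close> restores the order of
        exponents; the ideal is closed under negation.\<close>
      case False
      then have "(\<Prod>k\<in>UNIV. Var k ^ b k) - (\<Prod>k\<in>UNIV. Var k ^ a k) \<in> ?J"
        by (intro mem deg[symmetric]) (auto intro: ideal.span_base)
      from ideal.span_neg[OF this] show ?thesis by simp
    qed
    then show ?thesis
      unfolding toric_ideal_def[of "ext_gens m l v"] by (intro ideal.span_minimal) auto
  qed
  ultimately show ?thesis by (simp add: ideal_of_plus)
qed

theorem proposition2p4:
  fixes m :: "'n::finite \<Rightarrow> nat ^ 'd::finite" and l :: nat and v :: "nat ^ 'd"
    and V :: "('k::alg_closed_field ^ 'n) set" and W :: "('k ^ 'n option) set"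
    and T\<^sub>1 T\<^sub>2 :: "(nat ^ 'd) set"
  assumes "is_extension W V m l v"
  defines "T\<^sub>1 \<equiv> range (\<lambda>i. l *s m i)" and "T\<^sub>2 \<equiv> {v}"
  shows "(v \<noteq> 0 \<and> T\<^sub>1 \<inter> T\<^sub>2 = {} \<longrightarrow>
            is_gluing (nat_span (range (ext_gens m l v))) T\<^sub>1 T\<^sub>2) \<and>
         (\<forall>s. v = degS m s \<longrightarrow>
            (toric_ideal (ext_gens m l v) :: ('n option, 'k) mpoly set) =
              ideal_of (embed_poly ` toric_ideal m) +
              ideal_of {Var None ^ l - (\<Prod>i\<in>UNIV. Var (Some i) ^ s i)})"
proof -
  from assms(1) obtain j where v: "v \<in> nat_span (range m)" and l: "l > 0"
    and j: "coprime l (v $ j)"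
    unfolding is_extension_def by blast
  show ?thesis
    unfolding T\<^sub>1_def T\<^sub>2_def
    using is_gluing_extension[OF v l j] toric_ideal_extension[OF l j, where 'k = 'k] by auto
qed

end
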